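(* Let $\Gamma\in(1,2]$. Let $U^{-},U^{+}\in\mathcal G$ be two admissible states of the one-dimensional special relativistic hydrodynamics system, and let the wave speeds be $$s^{-}=\min\big(s_{\min}(U^{-}),s_{\min}(U^{+})\big),\qquad s^{+}=\max\big(s_{\max}(U^{-}),s_{\max}(U^{+})\big).$$ Then the two intermediate states $U^{\ast,-}$ and $U^{\ast,+}$ produced by the HLLC Riemann solver from $U^{-},U^{+}$ satisfy $U^{\ast,-}\in\mathcal G$ and $U^{\ast,+}\in\mathcal G$.
   Context: Units are such that the speed of light is $1$; $\Gamma\in(1,2]$ is the adiabatic index. Admissible states. For $\rho>0$, $p>0$, $|u|<1$ put $\gamma=(1-u^2)^{-1/2}$, $h=1+\frac{\Gamma p}{(\Gamma-1)\rho}$, $D=\rho\gamma$, $m=Dh\gamma u$, $E=Dh\gamma-p$. The admissible set $\mathcal G\subset\mathbb R^3$ is the set of all $U=(D,m,E)^T$ arising in this way (i.e. whose density, pressure and velocity satisfy $\rho>0$, $p>0$, $|u|<1$); the primitive variables $(\rho,u,p)$ are determined by $U\in\mathcal G$. Superscripts $\pm$ on $\rho,u,p,D,m,E$ refer to the states $U^{\pm}$. Wave speeds. $c_s=\sqrt{\Gamma p/(\rho h)}$, $s_{\min}(U)=\dfrac{u-c_s}{1-c_su}$, $s_{\max}(U)=\dfrac{u+c_s}{1+c_su}$. HLLC solver. Given $U^{\pm}\in\mathcal G$ and $s^{\pm}$, set $A^{\pm}=s^{\pm}E^{\pm}-m^{\pm}$, $B^{\pm}=m^{\pm}(s^{\pm}-u^{\pm})-p^{\pm}$,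 and $$\mathcal C_0=B^{+}-B^{-},\quad \mathcal C_1=A^{-}+s^{+}B^{-}-A^{+}-s^{-}B^{+},\quad \mathcal C_2=s^{-}A^{+}-s^{+}A^{-}.$$ The contact speed $s^{\ast}$ is the root $$s^{\ast}=\frac{-\mathcal C_1-\sqrt{\mathcal C_1^2-4\mathcal C_0\mathcal C_2}}{2\mathcal C_2}$$ of $\mathcal C_0+\mathcal C_1s+\mathcal C_2s^2=0$ (the root chosen because the wave speed should be less than $1$ in modulus); if $\mathcal C_2=0$, $s^\ast$ is the root $-\mathcal C_0/\mathcal C_1$ of the linear equation. The intermediate pressure is $$p^{\ast}=\frac{s^{\ast}A^{-}-B^{-}}{1-s^{-}s^{\ast}}=\frac{s^{\ast}A^{+}-B^{+}}{1-s^{+}s^{\ast}}.$$ The intermediate states $U^{\ast,\pm}=(D^{\ast,\pm},m^{\ast,\pm},E^{\ast,\pm})^T$ are defined by $$D^{\ast,\pm}(s^{\pm}-s^{\ast})=D^{\pm}(s^{\pm}-u^{\pm}),\quad m^{\ast,\pm}(s^{\pm}-s^{\ast})=m^{\pm}(s^{\pm}-u^{\pm})+p^{\ast}-p^{\pm},$$ $$E^{\ast,\pm}(s^{\pm}-s^{\ast})=E^{\pm}(s^{\pm}-u^{\pm})+p^{\ast}s^{\ast}-p^{\pm}u^{\pm}.$$ *)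

theory Defs
  imports "HOL-Analysis.Analysis"
begin

text \<open>
  One-dimensional special relativistic hydrodynamics with the ideal equation of state, in units
  where the speed of light is 1.  The adiabatic index is \<open>\<Gamma>\<close>.  A primitive state is a triple
  \<open>(\<rho>, u, p)\<close>, a conservative state \<open>U\<close> is the vector \<open>(D, m, E)\<close> of \<open>\<real>\<^sup>3\<close>, with components
  \<open>U$1\<close>, \<open>U$2\<close>, \<open>U$3\<close>.
\<close>

definition lorentz :: "real \<Rightarrow> real" where
  "lorentz u = 1 / sqrt (1 - u\<^sup>2)"

definition enthalpy :: "real \<Rightarrow> real \<Rightarrow> real \<Rightarrow> real" where
  "enthalpy \<Gamma> \<rho> p = 1 + \<Gamma> * p / ((\<Gamma> - 1) * \<rho>)"

definition cons_state :: "real \<Rightarrow> real \<times> real \<times> real \<Rightarrow> real ^ 3" where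
  "cons_state \<Gamma> = (\<lambda>(\<rho>, u, p).
     let \<gamma> = lorentz u; h = enthalpy \<Gamma> \<rho> p; D = \<rho> * \<gamma>
     in vector [D, D * h * \<gamma> * u, D * h * \<gamma> - p])"

definition prim_states :: "(real \<times> real \<times> real) set" where
  "prim_states = {(\<rho>, u, p). \<rho> > 0 \<and> p > 0 \<and> \<bar>u\<bar> < 1}"

definition admissible :: "real \<Rightarrow> (real ^ 3) set" where
  "admissible \<Gamma> = cons_state \<Gamma> ` prim_states"


text \<open>
  The primitive variables as functions of an admissible \<open>U\<close>.  They are well defined because
  \<open>cons_state \<Gamma>\<close> is injective on \<open>prim_states\<close>, see \<open>inj_on_cons_state\<close> below.
\<close>

definition prim :: "real \<Rightarrow> real ^ 3 \<Rightarrow> real \<times> real \<times> real" where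
  "prim \<Gamma> U = the_inv_into prim_states (cons_state \<Gamma>) U"

definition density :: "real \<Rightarrow> real ^ 3 \<Rightarrow> real" where
  "density \<Gamma> U = fst (prim \<Gamma> U)"

definition velocity :: "real \<Rightarrow> real ^ 3 \<Rightarrow> real" where
  "velocity \<Gamma> U = fst (snd (prim \<Gamma> U))"

definition pressure :: "real \<Rightarrow> real ^ 3 \<Rightarrow> real" where
  "pressure \<Gamma> U = snd (snd (prim \<Gamma> U))"

lemma lorentz_pos: "\<bar>u\<bar> < 1 \<Longrightarrow> lorentz u > 0"
  by (simp add: lorentz_def abs_square_less_1)

lemma lorentz_sq: "\<bar>u\<bar> < 1 \<Longrightarrow> (lorentz u)\<^sup>2 * (1 - u\<^sup>2) = 1"
proof -
  assume "\<bar>u\<bar> < 1"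
  then have "u\<^sup>2 < 1" by (simp add: abs_square_less_1)
  then show ?thesis by (simp add: lorentz_def power_divide)
qed

lemma cons_state_nth:
  "cons_state \<Gamma> (\<rho>, u, p) $ 1 = \<rho> * lorentz u"
  "cons_state \<Gamma> (\<rho>, u, p) $ 2 = \<rho> * lorentz u * enthalpy \<Gamma> \<rho> p * lorentz u * u"
  "cons_state \<Gamma> (\<rho>, u, p) $ 3 = \<rho> * lorentz u * enthalpy \<Gamma> \<rho> p * lorentz u - p"
  by (simp_all add: cons_state_def Let_def vector_3)

lemma cons_state_relations:
  assumes "1 < \<Gamma>" "\<rho> > 0" "p > 0" "\<bar>u\<bar> < 1"
  defines "U \<equiv> cons_state \<Gamma> (\<rho>, u, p)"
  shows "U$1 > 0" "U$3 + p > 0" "U$2 = (U$3 + p) * u"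
    "\<Gamma> / (\<Gamma> - 1) * p = (U$3 + p) * (1 - u\<^sup>2) - U$1 * sqrt (1 - u\<^sup>2)"
proof -
  let ?g = "lorentz u" and ?h = "enthalpy \<Gamma> \<rho> p"
  have g: "?g > 0" using lorentz_pos assms by simp
  have h: "?h > 0" using assms by (simp add: enthalpy_def add_pos_pos)
  have u2: "1 - u\<^sup>2 > 0" using assms by (simp add: abs_square_less_1)
  show "U$1 > 0" using g assms by (simp add: U_def cons_state_nth)
  show "U$3 + p > 0" using g h assms by (simp add: U_def cons_state_nth)
  show "U$2 = (U$3 + p) * u" by (simp add: U_def cons_state_nth)
  have s: "?g * sqrt (1 - u\<^sup>2) = 1" using u2 by (simp add: lorentz_def)
  have "(U$3 + p) * (1 - u\<^sup>2) = \<rho> * ?h * (?g\<^sup>2 * (1 - u\<^sup>2))"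
    by (simp add: U_def cons_state_nth power2_eq_square)
  also have "\<dots> = \<rho> * ?h" using lorentz_sq assms by simp
  also have "\<dots> = \<rho> + \<Gamma> / (\<Gamma> - 1) * p" using assms by (simp add: enthalpy_def field_simps)
  finally have a: "(U$3 + p) * (1 - u\<^sup>2) = \<rho> + \<Gamma> / (\<Gamma> - 1) * p" .
  have "U$1 * sqrt (1 - u\<^sup>2) = \<rho>" using s by (simp add: U_def cons_state_nth)
  with a show "\<Gamma> / (\<Gamma> - 1) * p = (U$3 + p) * (1 - u\<^sup>2) - U$1 * sqrt (1 - u\<^sup>2)" by simp
qed

lemma cons_state_pressure_le:
  assumes G: "1 < \<Gamma>" "\<Gamma> \<le> 2"
    and 1: "\<rho>1 > 0" "p1 > 0" "\<bar>u1\<bar> < 1" and 2: "\<rho>2 > 0" "p2 > 0" "\<bar>u2\<bar> < 1"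
    and eq: "cons_state \<Gamma> (\<rho>1, u1, p1) = cons_state \<Gamma> (\<rho>2, u2, p2)"
  shows "p2 \<le> p1"
proof (rule ccontr)
  assume "\<not> p2 \<le> p1"
  then have lt: "p1 < p2" by simp
  define U where "U = cons_state \<Gamma> (\<rho>1, u1, p1)"
  define x1 where "x1 = U$3 + p1"
  define x2 where "x2 = U$3 + p2"
  note r1 = cons_state_relations[OF G(1) 1, folded U_def, folded x1_def]
  note r2 = cons_state_relations[OF G(1) 2, folded eq, folded U_def, folded x2_def]
  have x: "x1 < x2" "x2 - x1 = p2 - p1" using lt by (simp_all add: x1_def x2_def)
  have m: "x1 * u1 = x2 * u2" using r1(3) r2(3) by simp
  have k: "\<Gamma> / (\<Gamma> - 1) \<ge> 2" using G by (simp add: field_simps)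
  have "\<bar>x1 * u1\<bar> = \<bar>x2 * u2\<bar>" using m by simp
  then have m': "x1 * \<bar>u1\<bar> = x2 * \<bar>u2\<bar>" using r1(2) r2(2) by (simp add: abs_mult)
  have "\<bar>u2\<bar> \<le> \<bar>u1\<bar>"
  proof (rule ccontr)
    assume "\<not> \<bar>u2\<bar> \<le> \<bar>u1\<bar>"
    then have "x1 * \<bar>u1\<bar> < x2 * \<bar>u2\<bar>" using x r1(2) by (intro mult_strict_mono) auto
    with m' show False by simp
  qed
  then have "u2\<^sup>2 \<le> u1\<^sup>2" by (simp add: abs_le_square_iff)
  then have "sqrt (1 - u1\<^sup>2) \<le> sqrt (1 - u2\<^sup>2)" by simp
  then have D: "U$1 * sqrt (1 - u1\<^sup>2) \<le> U$1 * sqrt (1 - u2\<^sup>2)" using r1(1) by simp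
  have "u1 * u2 \<ge> 0"
    using m r1(2) r2(2) by (smt (verit) mult_nonneg_nonneg mult_nonpos_nonpos mult_pos_neg mult_pos_pos)
  moreover have "\<bar>u1 * u2\<bar> < 1" 
    using mult_strict_mono'[OF 1(3) 2(3)] by (simp add: abs_mult)
  ultimately have v: "u1 * u2 < 1" by simp
  have "x1 * u1\<^sup>2 - x2 * u2\<^sup>2 = (x1 * u1) * u1 - (x2 * u2) * u2" by (simp add: power2_eq_square)
  also have "\<dots> = (x2 * u2) * u1 - (x1 * u1) * u2" using m by simp
  also have "\<dots> = (x2 - x1) * (u1 * u2)" by (simp add: algebra_simps)
  also have "\<dots> < x2 - x1" using v x(1) by simp
  finally have "x2 * (1 - u2\<^sup>2) - x1 * (1 - u1\<^sup>2) < 2 * (p2 - p1)"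
    using x(2) by (simp add: algebra_simps)
  moreover have "\<Gamma> / (\<Gamma> - 1) * (p2 - p1) \<ge> 2 * (p2 - p1)" using k lt by (intro mult_right_mono) auto
  moreover have "\<Gamma> / (\<Gamma> - 1) * (p2 - p1) = \<Gamma> / (\<Gamma> - 1) * p2 - \<Gamma> / (\<Gamma> - 1) * p1"
    by (rule right_diff_distrib)
  ultimately show False using r1(4) r2(4) D by linarith
qed

lemma inj_on_cons_state:
  assumes "1 < \<Gamma>" "\<Gamma> \<le> 2"
  shows "inj_on (cons_state \<Gamma>) prim_states"
proof (rule inj_onI, unfold split_paired_all)
  fix \<rho>1 u1 p1 \<rho>2 u2 p2 :: real
  assume "(\<rho>1, u1, p1) \<in> prim_states" "(\<rho>2, u2, p2) \<in> prim_states"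
  then have 1: "\<rho>1 > 0" "p1 > 0" "\<bar>u1\<bar> < 1" and 2: "\<rho>2 > 0" "p2 > 0" "\<bar>u2\<bar> < 1"
    by (auto simp: prim_states_def)
  assume eq: "cons_state \<Gamma> (\<rho>1, u1, p1) = cons_state \<Gamma> (\<rho>2, u2, p2)"
  have p: "p1 = p2"
    using cons_state_pressure_le[OF assms 1 2 eq] cons_state_pressure_le[OF assms 2 1 eq[symmetric]]
    by simp
  note r1 = cons_state_relations[OF assms(1) 1]
  note r2 = cons_state_relations[OF assms(1) 2, folded eq]
  have u: "u1 = u2" using r1(2,3) r2(3) p by simp
  have "\<rho>1 * lorentz u1 = \<rho>2 * lorentz u2"
    using arg_cong[OF eq, of "\<lambda>U. U $ 1"] by (simp add: cons_state_nth)
  then have "\<rho>1 = \<rho>2" using u lorentz_pos[OF 2(3)] by simp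
  with p u show "(\<rho>1, u1, p1) = (\<rho>2, u2, p2)" by simp
qed

lemma prim_cons_state:
  assumes "1 < \<Gamma>" "\<Gamma> \<le> 2" "\<rho> > 0" "p > 0" "\<bar>u\<bar> < 1"
  shows "prim \<Gamma> (cons_state \<Gamma> (\<rho>, u, p)) = (\<rho>, u, p)"
  unfolding prim_def
  by (rule the_inv_into_f_f[OF inj_on_cons_state]) (use assms in \<open>auto simp: prim_states_def\<close>)


definition sound_speed :: "real \<Rightarrow> real ^ 3 \<Rightarrow> real" where
  "sound_speed \<Gamma> U =
     sqrt (\<Gamma> * pressure \<Gamma> U / (density \<Gamma> U * enthalpy \<Gamma> (density \<Gamma> U) (pressure \<Gamma> U)))"

definition s_min :: "real \<Rightarrow> real ^ 3 \<Rightarrow> real" where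
  "s_min \<Gamma> U = (velocity \<Gamma> U - sound_speed \<Gamma> U) / (1 - sound_speed \<Gamma> U * velocity \<Gamma> U)"

definition s_max :: "real \<Rightarrow> real ^ 3 \<Rightarrow> real" where
  "s_max \<Gamma> U = (velocity \<Gamma> U + sound_speed \<Gamma> U) / (1 + sound_speed \<Gamma> U * velocity \<Gamma> U)"


definition hllc_A :: "real \<Rightarrow> real ^ 3 \<Rightarrow> real" where
  "hllc_A s U = s * U$3 - U$2"

definition hllc_B :: "real \<Rightarrow> real \<Rightarrow> real ^ 3 \<Rightarrow> real" where
  "hllc_B \<Gamma> s U = U$2 * (s - velocity \<Gamma> U) - pressure \<Gamma> U"

text \<open>
  In what follows \<open>sm\<close>, \<open>sp\<close> are the speeds \<open>s\<^sup>-\<close>, \<open>s\<^sup>+\<close> of the left and right outer waves, and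
  \<open>Um\<close>, \<open>Up\<close> are the left and right states.
\<close>

definition hllc_C0 :: "real \<Rightarrow> real \<Rightarrow> real \<Rightarrow> real ^ 3 \<Rightarrow> real ^ 3 \<Rightarrow> real" where
  "hllc_C0 \<Gamma> sm sp Um Up = hllc_B \<Gamma> sp Up - hllc_B \<Gamma> sm Um"

definition hllc_C1 :: "real \<Rightarrow> real \<Rightarrow> real \<Rightarrow> real ^ 3 \<Rightarrow> real ^ 3 \<Rightarrow> real" where
  "hllc_C1 \<Gamma> sm sp Um Up =
     hllc_A sm Um + sp * hllc_B \<Gamma> sm Um - hllc_A sp Up - sm * hllc_B \<Gamma> sp Up"

definition hllc_C2 :: "real \<Rightarrow> real \<Rightarrow> real ^ 3 \<Rightarrow> real ^ 3 \<Rightarrow> real" where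
  "hllc_C2 sm sp Um Up = sm * hllc_A sp Up - sp * hllc_A sm Um"

definition contact_speed :: "real \<Rightarrow> real \<Rightarrow> real \<Rightarrow> real ^ 3 \<Rightarrow> real ^ 3 \<Rightarrow> real" where
  "contact_speed \<Gamma> sm sp Um Up =
     (let C0 = hllc_C0 \<Gamma> sm sp Um Up; C1 = hllc_C1 \<Gamma> sm sp Um Up; C2 = hllc_C2 sm sp Um Up
      in if C2 = 0 then - C0 / C1 else (- C1 - sqrt (C1\<^sup>2 - 4 * C0 * C2)) / (2 * C2))"

text \<open>
  The contact speed is a root of \<open>C0 + C1 s + C2 s\<^sup>2\<close>, and this is exactly what makes the expressions
  for the intermediate pressure on the two sides agree (lemma \<open>star_pressure_sides\<close>); the left one
  is taken as the definition.
\<close>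

definition star_pressure :: "real \<Rightarrow> real \<Rightarrow> real \<Rightarrow> real ^ 3 \<Rightarrow> real ^ 3 \<Rightarrow> real" where
  "star_pressure \<Gamma> sm sp Um Up =
     (let s = contact_speed \<Gamma> sm sp Um Up
      in (s * hllc_A sm Um - hllc_B \<Gamma> sm Um) / (1 - sm * s))"

lemma star_pressure_sides:
  fixes s :: real
  assumes "1 - sm * s \<noteq> 0" "1 - sp * s \<noteq> 0"
  shows "(s * hllc_A sm Um - hllc_B \<Gamma> sm Um) / (1 - sm * s)
           = (s * hllc_A sp Up - hllc_B \<Gamma> sp Up) / (1 - sp * s)
     \<longleftrightarrow> hllc_C0 \<Gamma> sm sp Um Up + hllc_C1 \<Gamma> sm sp Um Up * s + hllc_C2 sm sp Um Up * s\<^sup>2 = 0"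
  using assms
  by (simp add: frac_eq_eq hllc_C0_def hllc_C1_def hllc_C2_def algebra_simps power2_eq_square)

text \<open>
  The intermediate state behind the outer wave of speed \<open>s\<close> adjacent to the state \<open>U\<close>, given the
  contact speed \<open>sc\<close> and the intermediate pressure \<open>ps\<close>.  If \<open>s = sc\<close>, the first component is
  \<open>0\<close> by the convention on division by zero, so the result is not admissible: admissibility of the
  intermediate state includes \<open>s \<noteq> sc\<close>.
\<close>

definition star_state :: "real \<Rightarrow> real \<Rightarrow> real \<Rightarrow> real \<Rightarrow> real ^ 3 \<Rightarrow> real ^ 3" where
  "star_state \<Gamma> s sc ps U =
     (let u = velocity \<Gamma> U; p = pressure \<Gamma> U
      in vector [U$1 * (s - u) / (s - sc),
                 (U$2 * (s - u) + ps - p) / (s - sc),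
                 (U$3 * (s - u) + ps * sc - p * u) / (s - sc)])"

definition hllc_minus :: "real \<Rightarrow> real \<Rightarrow> real \<Rightarrow> real ^ 3 \<Rightarrow> real ^ 3 \<Rightarrow> real ^ 3" where
  "hllc_minus \<Gamma> sm sp Um Up =
     star_state \<Gamma> sm (contact_speed \<Gamma> sm sp Um Up) (star_pressure \<Gamma> sm sp Um Up) Um"

definition hllc_plus :: "real \<Rightarrow> real \<Rightarrow> real \<Rightarrow> real ^ 3 \<Rightarrow> real ^ 3 \<Rightarrow> real ^ 3" where
  "hllc_plus \<Gamma> sm sp Um Up =
     star_state \<Gamma> sp (contact_speed \<Gamma> sm sp Um Up) (star_pressure \<Gamma> sm sp Um Up) Up"

end

theory Submission
  imports Defs
begin

text \<open>
  The admissible set is the cone \<open>D > 0\<close>,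
  \<open>E > sqrt (D\<^sup>2 + m\<^sup>2)\<close>.  Across an outer wave of speed \<open>s\<close> the vector \<open>s U - F(U)\<close> has components
  \<open>D (s - u)\<close>, \<open>B\<close>, \<open>A\<close>; if \<open>s\<close> lies beyond the sound cone of \<open>U\<close>, it is, up to the sign of
  \<open>s - u\<close>, in the admissible cone.  In particular \<open>\<bar>B\<bar> < \<bar>A\<bar>\<close>, so the contact quadratic is positive
  at \<open>-1\<close> and negative at \<open>1\<close>, and the contact speed \<open>x\<close> is its only root in between.  It separates
  \<open>s\<^sup>-\<close> from \<open>s\<^sup>+\<close> because \<open>s\<^sup>+ A\<^sup>- - B\<^sup>- < 0 < s\<^sup>+ A\<^sup>+ - B\<^sup>+\<close>, where both outer speeds are
  supersonic for both states.  Finally \<open>(s - x) U\<^sup>*\<close> equals \<open>s U - F(U) + (0, p\<^sup>*, p\<^sup>* x)\<close>, and the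
  definition of \<open>p\<^sup>*\<close> turns its Lorentz form into
  \<open>A\<^sup>2 - B\<^sup>2 - D\<^sup>2 (s - u)\<^sup>2 + p\<^sup>*\<^sup>2 (1 - 2 s x + x\<^sup>2)\<close>, which is positive whatever the sign of \<open>p\<^sup>*\<close>.
\<close>

lemma one_minus_mult_pos:
  fixes a b :: real
  assumes "\<bar>a\<bar> < 1" "\<bar>b\<bar> < 1"
  shows "1 - a * b > 0"
proof -
  have "\<bar>a * b\<bar> < 1" using mult_strict_mono'[OF assms] by (simp add: abs_mult)
  then show ?thesis by simp
qed

section \<open>The admissible cone\<close>

text \<open>The equation is the pressure relation of \<open>cons_state_relations\<close> with
  \<open>k\<close> for \<open>\<Gamma> / (\<Gamma> - 1)\<close> and the velocity eliminated by
  \<open>u = m / (E + p)\<close>. The intermediate value theorem solves it: the difference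
  \<open>f\<close> of the two sides is negative at \<open>0\<close>, where the cone condition says
  \<open>D < E * sqrt (1 - (m / E)\<^sup>2)\<close>, and positive at a large pressure.\<close>

lemma admissible_pressure_exists:
  fixes k D m E :: real
  assumes "k > 1" "D > 0" "sqrt (D\<^sup>2 + m\<^sup>2) < E"
  obtains p where "p > 0"
    "k * p = (E + p) * (1 - (m / (E + p))\<^sup>2) - D * sqrt (1 - (m / (E + p))\<^sup>2)"
proof -
  have "\<bar>m\<bar> \<le> sqrt (D\<^sup>2 + m\<^sup>2)" by (rule real_le_rsqrt) simp
  with assms(3) have mE: "\<bar>m\<bar> < E" by linarith
  then have E: "E > 0" by linarith
  have DE: "D\<^sup>2 + m\<^sup>2 < E\<^sup>2" 
  proof -
    have "(sqrt (D\<^sup>2 + m\<^sup>2))\<^sup>2 < E\<^sup>2" using assms(3) by (intro power_strict_mono) auto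
    then show ?thesis by simp
  qed
  define f where "f = (\<lambda>p. k * p - ((E + p) * (1 - (m / (E + p))\<^sup>2) - D * sqrt (1 - (m / (E + p))\<^sup>2)))"
  \<comment> \<open>Chosen so that \<open>k * P = E + P\<close>, which already exceeds the
    right-hand side of the equation at \<open>P\<close>.\<close>
  define P where "P = E / (k - 1)"
  have P: "P > 0" using E assms by (simp add: P_def)
  have v: "(m / (E + p))\<^sup>2 < 1" if "p \<ge> 0" for p
    using mE that by (simp add: abs_square_less_1)
  have "f 0 < 0"
  proof -
    let ?r = "sqrt (1 - (m / E)\<^sup>2)"
    have r: "?r > 0" using v[of 0] by simp
    have rr: "?r\<^sup>2 = 1 - (m / E)\<^sup>2" using v[of 0] by simp
    have "(E * ?r)\<^sup>2 = E\<^sup>2 - m\<^sup>2" using E by (simp add: power_mult_distrib rr) (simp add: field_simps)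
    then have "D\<^sup>2 < (E * ?r)\<^sup>2" using DE by simp
    then have "D < E * ?r" using E r by (meson less_imp_le mult_pos_pos power_less_imp_less_base)
    then have "?r * (E * ?r - D) > 0" using r by simp
    moreover have "f 0 = - (E * ?r\<^sup>2 - D * ?r)" unfolding f_def rr by simp
    then have "f 0 = - (?r * (E * ?r - D))" by (simp only: power2_eq_square) (simp only: algebra_simps)
    ultimately show ?thesis by simp
  qed
  moreover have "f P > 0"
  proof -
    have "(E + P) * (1 - (m / (E + P))\<^sup>2) \<le> (E + P) * 1"
      using E P by (intro mult_left_mono) auto
    moreover have "D * sqrt (1 - (m / (E + P))\<^sup>2) > 0" using assms(2) v[of P] P by simp
    moreover have "k * P = E + P" using assms by (simp add: P_def field_simps)
    ultimately show ?thesis by (simp add: f_def)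
  qed
  moreover have "continuous_on {0..P} f"
    unfolding f_def using E by (auto intro!: continuous_intros)
  ultimately obtain p where p: "0 \<le> p" "p \<le> P" "f p = 0"
    using IVT'[of f 0 0 P] P by auto
  with \<open>f 0 < 0\<close> have "p > 0" by (cases "p = 0") auto
  with p(3) show ?thesis using that by (simp add: f_def)
qed

text \<open>With \<open>p\<close> from the previous lemma, \<open>u = m / (E + p)\<close> and
  \<open>\<rho> = D * sqrt (1 - u\<^sup>2)\<close> reproduce \<open>m\<close> and \<open>D\<close>
  by construction. The equation for \<open>p\<close> becomes
  \<open>\<rho> h = (E + p) * (1 - u\<^sup>2)\<close>, which reproduces \<open>E\<close>.\<close>

lemma admissibleI:
  assumes G: "1 < \<Gamma>" and D: "U$1 > 0" and q: "sqrt ((U$1)\<^sup>2 + (U$2)\<^sup>2) < U$3"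
  shows "U \<in> admissible \<Gamma>"
proof -
  define k where "k = \<Gamma> / (\<Gamma> - 1)"
  have k: "k > 1" using G by (simp add: k_def field_simps)
  obtain p where p: "p > 0" and eq: "k * p = (U$3 + p) * (1 - (U$2 / (U$3 + p))\<^sup>2)
      - U$1 * sqrt (1 - (U$2 / (U$3 + p))\<^sup>2)"
    using admissible_pressure_exists[OF k D q] by metis
  define u where "u = U$2 / (U$3 + p)"
  define r where "r = sqrt (1 - u\<^sup>2)"
  have "\<bar>U$2\<bar> \<le> sqrt ((U$1)\<^sup>2 + (U$2)\<^sup>2)" by (rule real_le_rsqrt) simp
  with q p have E: "\<bar>U$2\<bar> < U$3 + p" by linarith
  then have u: "\<bar>u\<bar> < 1" by (simp add: u_def)
  then have r: "r > 0" "r\<^sup>2 = 1 - u\<^sup>2" by (simp_all add: r_def abs_square_less_1 abs_square_le_1)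
  have m: "U$2 = (U$3 + p) * u" using E by (simp add: u_def)
  define \<rho> where "\<rho> = U$1 * r"
  have \<rho>: "\<rho> > 0" using D r by (simp add: \<rho>_def)
  have e: "\<rho> * enthalpy \<Gamma> \<rho> p = (U$3 + p) * r\<^sup>2"
  proof -
    have "\<rho> * enthalpy \<Gamma> \<rho> p = \<rho> + k * p"
      using G \<rho> by (simp add: enthalpy_def k_def field_simps)
    also have "\<dots> = (U$3 + p) * r\<^sup>2"
      using eq[folded u_def] r by (simp add: \<rho>_def r_def)
    finally show ?thesis .
  qed
  have g: "lorentz u = 1 / r" by (simp add: lorentz_def r_def)
  have w: "\<rho> * lorentz u * enthalpy \<Gamma> \<rho> p * lorentz u = U$3 + p"
  proof -
    have "\<rho> * lorentz u * enthalpy \<Gamma> \<rho> p * lorentz u = (\<rho> * enthalpy \<Gamma> \<rho> p) / r\<^sup>2"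
      by (simp add: g power2_eq_square)
    then show ?thesis using r(1) by (simp add: e)
  qed
  have "cons_state \<Gamma> (\<rho>, u, p) = U"
    using r(1) by (simp add: vec_eq_iff forall_3 cons_state_nth w m[symmetric])
      (simp add: g \<rho>_def)
  moreover have "(\<rho>, u, p) \<in> prim_states" using \<rho> p u by (simp add: prim_states_def)
  ultimately show ?thesis unfolding admissible_def by blast
qed

text \<open>Here \<open>d\<close>, \<open>B\<close>, \<open>A\<close> stand for the components of
  \<open>s U - F(U)\<close>. Only the agreement in sign with \<open>s - x\<close> enters, so one
  lemma serves the left and the right wave.\<close>

lemma admissible_star:
  fixes A B d s x :: real
  assumes "1 < \<Gamma>" "\<bar>s\<bar> < 1" "\<bar>x\<bar> < 1"
    and cone: "B\<^sup>2 + d\<^sup>2 < A\<^sup>2" and sA: "(s - x) * A > 0" and sd: "(s - x) * d > 0"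
    and P: "P = (x * A - B) / (1 - s * x)"
  shows "vector [d / (s - x), (B + P) / (s - x), (A + P * x) / (s - x)] \<in> admissible \<Gamma>"
proof -
  have sx: "1 - s * x > 0" using one_minus_mult_pos assms by blast
  have P': "x * A - B = P * (1 - s * x)" using sx by (simp add: P)
  have "(A + P * x)\<^sup>2 - (B + P)\<^sup>2 - d\<^sup>2
      = A\<^sup>2 - B\<^sup>2 - d\<^sup>2 + 2 * P * (x * A - B) - P\<^sup>2 * (1 - x\<^sup>2)"
    by (simp add: power2_eq_square algebra_simps)
  \<comment> \<open>The cross term becomes \<open>2 * P\<^sup>2 * (1 - s * x)\<close>; together with
    \<open>- P\<^sup>2 * (1 - x\<^sup>2)\<close> it is a multiple of \<open>P\<^sup>2\<close> with a
    factor visibly nonnegative for subluminal \<open>s\<close>.\<close>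
  also have "\<dots> = (A\<^sup>2 - B\<^sup>2 - d\<^sup>2) + P\<^sup>2 * ((x - s)\<^sup>2 + (1 - s\<^sup>2))"
    unfolding P' by (simp add: power2_eq_square algebra_simps)
  finally have eq: "(A + P * x)\<^sup>2 - (B + P)\<^sup>2 - d\<^sup>2 = (A\<^sup>2 - B\<^sup>2 - d\<^sup>2) + P\<^sup>2 * ((x - s)\<^sup>2 + (1 - s\<^sup>2))" .
  have "P\<^sup>2 * ((x - s)\<^sup>2 + (1 - s\<^sup>2)) \<ge> 0"
    using assms(2) by (intro mult_nonneg_nonneg add_nonneg_nonneg) (simp_all add: abs_square_le_1)
  with eq cone have q: "d\<^sup>2 + (B + P)\<^sup>2 < (A + P * x)\<^sup>2" by linarith
  have BA: "\<bar>B\<bar> < \<bar>A\<bar>"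
  proof -
    have "B\<^sup>2 < A\<^sup>2" using cone zero_le_power2[of d] by linarith
    then show ?thesis by (simp add: abs_le_square_iff flip: not_le)
  qed
  \<comment> \<open>The Lorentz form leaves the sign of the energy open. Eliminating
    \<open>P\<close> gives \<open>A * (1 - s * x + x\<^sup>2) - x * B\<close>, where the first term
    dominates since \<open>\<bar>B\<bar> < \<bar>A\<bar>\<close> and
    \<open>1 - s * x + x\<^sup>2 - \<bar>x\<bar>\<close> is at least
    \<open>(1 - \<bar>x\<bar>)\<^sup>2\<close>.\<close>
  have "A * (A + P * x) > 0"
  proof -
    have "(1 - s * x) * (A + P * x) = A * (1 - s * x + x\<^sup>2) - x * B"
    proof -
      have "(1 - s * x) * (A + P * x) = A * (1 - s * x) + x * (P * (1 - s * x))"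
        by (simp add: algebra_simps)
      then show ?thesis unfolding P'[symmetric] by (simp add: power2_eq_square algebra_simps)
    qed
    then have "(1 - s * x) * (A * (A + P * x)) = A * (A * (1 - s * x + x\<^sup>2) - x * B)"
      by (metis mult.left_commute)
    then have "(1 - s * x) * (A * (A + P * x)) = A\<^sup>2 * (1 - s * x + x\<^sup>2) - x * (A * B)"
      by (simp only:) (simp add: power2_eq_square algebra_simps)
    moreover have "x * (A * B) \<le> A\<^sup>2 * \<bar>x\<bar>"
    proof -
      have "x * (A * B) \<le> \<bar>x\<bar> * (\<bar>A\<bar> * \<bar>B\<bar>)" by (metis abs_ge_self abs_mult)
      also have "\<dots> \<le> \<bar>x\<bar> * (\<bar>A\<bar> * \<bar>A\<bar>)" using BA by (intro mult_left_mono) auto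
      finally show ?thesis by (simp add: power2_eq_square mult.commute)
    qed
    moreover have "A\<^sup>2 * \<bar>x\<bar> < A\<^sup>2 * (1 - s * x + x\<^sup>2)"
    proof (rule mult_strict_left_mono)
      have "s * x \<le> \<bar>s\<bar> * \<bar>x\<bar>" by (metis abs_ge_self abs_mult)
      also have "\<dots> \<le> 1 * \<bar>x\<bar>" using assms by (intro mult_right_mono) auto
      finally have "s * x \<le> \<bar>x\<bar>" by simp
      moreover have "0 < (1 - \<bar>x\<bar>)\<^sup>2" using assms(3) by simp
      then have "0 < 1 - 2 * \<bar>x\<bar> + x\<^sup>2" by (simp add: power2_diff)
      ultimately show "\<bar>x\<bar> < 1 - s * x + x\<^sup>2" by linarith
      show "0 < A\<^sup>2" using BA by auto
    qed
    ultimately have "(1 - s * x) * (A * (A + P * x)) > 0" by linarith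
    then show ?thesis using sx by (simp add: zero_less_mult_iff)
  qed
  with sA have "(s - x) * (A + P * x) > 0" by (auto simp: zero_less_mult_iff)
  then have E: "(A + P * x) / (s - x) > 0" by (auto simp: zero_less_mult_iff zero_less_divide_iff)
  have D: "d / (s - x) > 0" using sd by (auto simp: zero_less_mult_iff zero_less_divide_iff)
  have "(s - x)\<^sup>2 > 0" using sA by auto
  then have "(d / (s - x))\<^sup>2 + ((B + P) / (s - x))\<^sup>2 < ((A + P * x) / (s - x))\<^sup>2"
    using q by (simp add: power_divide add_divide_distrib[symmetric] divide_strict_right_mono)
  then have "sqrt ((d / (s - x))\<^sup>2 + ((B + P) / (s - x))\<^sup>2) < (A + P * x) / (s - x)"
    using E by (intro real_less_lsqrt) auto
  with D show ?thesis using assms(1) by (intro admissibleI) simp_all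
qed

section \<open>States and supersonic speeds\<close>

text \<open>\<open>W\<close> is \<open>\<rho> h\<close>, so
  \<open>E + p = W \<gamma>\<^sup>2\<close>, and the sound speed enters only through its square. The
  bound on that square is \<open>\<Gamma> p < (\<Gamma> - 1) W\<close>, which is positivity of
  \<open>\<rho>\<close>.\<close>

lemma admissible_primitives:
  assumes G: "1 < \<Gamma>" "\<Gamma> \<le> 2" and "U \<in> admissible \<Gamma>"
  obtains \<rho> W where "\<rho> > 0" "pressure \<Gamma> U > 0" "\<bar>velocity \<Gamma> U\<bar> < 1"
    "W = \<rho> + \<Gamma> / (\<Gamma> - 1) * pressure \<Gamma> U"
    "U$1 = \<rho> * lorentz (velocity \<Gamma> U)"
    "U$3 = W * (lorentz (velocity \<Gamma> U))\<^sup>2 - pressure \<Gamma> U"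
    "U$2 = W * (lorentz (velocity \<Gamma> U))\<^sup>2 * velocity \<Gamma> U"
    "sound_speed \<Gamma> U \<ge> 0" "W * (sound_speed \<Gamma> U)\<^sup>2 = \<Gamma> * pressure \<Gamma> U"
    "(sound_speed \<Gamma> U)\<^sup>2 < \<Gamma> - 1"
proof -
  obtain \<rho> u p where pr: "\<rho> > 0" "p > 0" "\<bar>u\<bar> < 1" and U: "U = cons_state \<Gamma> (\<rho>, u, p)"
    using assms(3) by (auto simp: admissible_def prim_states_def)
  have prim: "prim \<Gamma> U = (\<rho>, u, p)" unfolding U using G pr by (rule prim_cons_state)
  then have v: "velocity \<Gamma> U = u" "pressure \<Gamma> U = p" "density \<Gamma> U = \<rho>"
    by (simp_all add: velocity_def pressure_def density_def)
  define W where "W = \<rho> + \<Gamma> / (\<Gamma> - 1) * p"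
  have W: "\<rho> * enthalpy \<Gamma> \<rho> p = W"
    using G pr by (simp add: enthalpy_def W_def field_simps)
  have W0: "W > 0" using G pr by (simp add: W_def add_pos_pos)
  have c: "sound_speed \<Gamma> U = sqrt (\<Gamma> * p / W)" by (simp add: sound_speed_def v W)
  have c2: "(sound_speed \<Gamma> U)\<^sup>2 = \<Gamma> * p / W" using G pr W0 by (simp add: c)
  have "\<Gamma> * p < (\<Gamma> - 1) * W" using G pr by (simp add: W_def distrib_left)
  then have c3: "\<Gamma> * p / W < \<Gamma> - 1" using W0 by (simp add: pos_divide_less_eq)
  have g: "\<rho> * lorentz u * enthalpy \<Gamma> \<rho> p * lorentz u = W * (lorentz u)\<^sup>2"
    unfolding W[symmetric] by (simp add: power2_eq_square)
  show ?thesis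
  proof (rule that[of \<rho> W])
    show "U$3 = W * (lorentz (velocity \<Gamma> U))\<^sup>2 - pressure \<Gamma> U"
      "U$2 = W * (lorentz (velocity \<Gamma> U))\<^sup>2 * velocity \<Gamma> U"
      using g unfolding v by (simp_all add: U cons_state_nth)
    show "sound_speed \<Gamma> U \<ge> 0" using c G pr W0 by simp
    show "U$1 = \<rho> * lorentz (velocity \<Gamma> U)" unfolding v by (simp add: U cons_state_nth)
  qed (use pr W0 c2 c3 in \<open>simp_all add: v W_def\<close>)
qed

text \<open>The absolute value in the hypothesis covers speeds on either side of the sound cone.
  After multiplication by the squared sound speed \<open>C\<close>, the hypothesis bounds the only
  negative term of the Lorentz form by a multiple of \<open>g * v\<^sup>2\<close>. What remains is
  \<open>key\<close>, an inequality without \<open>s\<close>.\<close>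

lemma outer_wave_cone:
  assumes G: "1 < \<Gamma>" "\<Gamma> \<le> 2" and U: "U \<in> admissible \<Gamma>" and s: "\<bar>s\<bar> < 1"
    and c: "sound_speed \<Gamma> U * (1 - s * velocity \<Gamma> U) \<le> \<bar>s - velocity \<Gamma> U\<bar>"
  shows "(hllc_B \<Gamma> s U)\<^sup>2 + (U$1 * (s - velocity \<Gamma> U))\<^sup>2 < (hllc_A s U)\<^sup>2"
    and "0 < (s - velocity \<Gamma> U) * hllc_A s U"
proof -
  obtain \<rho> W where *: "\<rho> > 0" "pressure \<Gamma> U > 0" "\<bar>velocity \<Gamma> U\<bar> < 1"
    "W = \<rho> + \<Gamma> / (\<Gamma> - 1) * pressure \<Gamma> U"
    "U$1 = \<rho> * lorentz (velocity \<Gamma> U)"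
    "U$3 = W * (lorentz (velocity \<Gamma> U))\<^sup>2 - pressure \<Gamma> U"
    "U$2 = W * (lorentz (velocity \<Gamma> U))\<^sup>2 * velocity \<Gamma> U"
    "sound_speed \<Gamma> U \<ge> 0" "W * (sound_speed \<Gamma> U)\<^sup>2 = \<Gamma> * pressure \<Gamma> U"
    "(sound_speed \<Gamma> U)\<^sup>2 < \<Gamma> - 1"
    using admissible_primitives[OF G U] by metis
  define u where "u = velocity \<Gamma> U"
  define p where "p = pressure \<Gamma> U"
  define g where "g = (lorentz u)\<^sup>2"
  define C where "C = (sound_speed \<Gamma> U)\<^sup>2"
  define k where "k = \<Gamma> / (\<Gamma> - 1)"
  define v where "v = s - u"
  define A where "A = hllc_A s U"
  define B where "B = hllc_B \<Gamma> s U"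
  note pr = *[folded u_def p_def C_def, folded g_def k_def]
  have k: "k \<ge> 2" using G by (simp add: k_def field_simps)
  have kG: "k * \<Gamma> = k + \<Gamma>" using G by (simp add: k_def field_simps)
  have g: "g * (1 - u\<^sup>2) = 1" using lorentz_sq pr(3) by (simp add: g_def)
  have su: "1 - s * u > 0" using one_minus_mult_pos s pr(3) by blast
  have W: "W = \<rho> + k * p" using pr(4) by simp
  have kp: "k * p \<ge> 2 * p" using k pr(2) by simp
  then have W2: "W > 2 * p" using W pr(1) by simp
  have W0: "W > 0" using W2 pr(2) by simp
  have v2: "C * (1 - s * u)\<^sup>2 \<le> v\<^sup>2"
  proof -
    have "(sound_speed \<Gamma> U * (1 - s * u))\<^sup>2 \<le> \<bar>v\<bar>\<^sup>2"
      using c pr(8) su by (intro power_mono) (auto simp: u_def v_def)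
    then show ?thesis by (simp add: power_mult_distrib C_def)
  qed
  \<comment> \<open>Invariance under the boost to the rest frame of the fluid, where the wave has
    speed \<open>v / (1 - s * u)\<close>.\<close>
  have s2: "1 - s\<^sup>2 = g * ((1 - s * u)\<^sup>2 - v\<^sup>2)"
  proof -
    have "(1 - s * u)\<^sup>2 - v\<^sup>2 = (1 - s\<^sup>2) * (1 - u\<^sup>2)"
      by (simp add: v_def power2_eq_square algebra_simps)
    then have "g * ((1 - s * u)\<^sup>2 - v\<^sup>2) = (1 - s\<^sup>2) * (g * (1 - u\<^sup>2))" by simp
    then show ?thesis by (simp add: g)
  qed
  have g0: "g > 0" using lorentz_pos[OF pr(3)] by (simp add: g_def)
  have C0: "C > 0"
  proof -
    have "W * C > 0" using pr(2,9) G by simp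
    then show ?thesis using W0 by (simp add: zero_less_mult_iff)
  qed
  have v0: "v\<^sup>2 > 0" using v2 C0 su by (meson less_le_trans mult_pos_pos zero_less_power)
  have s2': "C * (1 - s\<^sup>2) \<le> g * v\<^sup>2 * (1 - C)"
  proof -
    have "C * (1 - s\<^sup>2) = g * (C * (1 - s * u)\<^sup>2 - C * v\<^sup>2)" unfolding s2 by (simp add: algebra_simps)
    also have "\<dots> \<le> g * (v\<^sup>2 - C * v\<^sup>2)" using v2 g0 by (intro mult_left_mono) auto
    finally show ?thesis by (simp add: algebra_simps)
  qed
  \<comment> \<open>Multiplying by \<open>W\<close> allows \<open>W * C = \<Gamma> * p\<close>. With
    \<open>k * \<Gamma> = k + \<Gamma>\<close> the difference of the sides is
    \<open>p\<^sup>2 * ((2 * k - 1) * \<rho> + k * (k - 2) * p)\<close>; the condition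
    \<open>\<Gamma> \<le> 2\<close> enters as \<open>k \<ge> 2\<close>.\<close>
  have key: "p\<^sup>2 * (1 - C) < C * (W\<^sup>2 - 2 * W * p - \<rho>\<^sup>2)"
  proof -
    have "W\<^sup>2 - 2 * W * p - \<rho>\<^sup>2 = (2 * k - 2) * \<rho> * p + k * (k - 2) * p\<^sup>2"
      by (simp add: W power2_eq_square algebra_simps)
    then have "W * (C * (W\<^sup>2 - 2 * W * p - \<rho>\<^sup>2)) = \<Gamma> * p * ((2 * k - 2) * \<rho> * p + k * (k - 2) * p\<^sup>2)"
      using pr(9) by (simp add: mult.assoc[symmetric])
    moreover have "W - W * C = \<rho> + (k - \<Gamma>) * p" using pr(9) W by (simp add: left_diff_distrib)
    then have "p\<^sup>2 * (W - W * C) = p\<^sup>2 * (\<rho> + (k - \<Gamma>) * p)" by simp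
    then have "W * (p\<^sup>2 * (1 - C)) = p\<^sup>2 * (\<rho> + (k - \<Gamma>) * p)" by (simp add: algebra_simps)
    moreover have "\<Gamma> * p * ((2 * k - 2) * \<rho> * p + k * (k - 2) * p\<^sup>2) - p\<^sup>2 * (\<rho> + (k - \<Gamma>) * p)
        = p\<^sup>2 * ((\<Gamma> * (2 * k - 2) - 1) * \<rho> + (k * \<Gamma> * (k - 2) - (k - \<Gamma>)) * p)"
      by (simp add: power2_eq_square algebra_simps)
    moreover have "p\<^sup>2 * ((\<Gamma> * (2 * k - 2) - 1) * \<rho> + (k * \<Gamma> * (k - 2) - (k - \<Gamma>)) * p) > 0"
    proof (intro mult_pos_pos add_pos_nonneg mult_nonneg_nonneg)
      have "k * \<Gamma> * (k - 2) - (k - \<Gamma>) = k * (k * \<Gamma>) - 2 * (k * \<Gamma>) - k + \<Gamma>"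
        by (simp add: algebra_simps)
      also have "\<dots> = k * (k - 2)"
        unfolding kG using kG by (simp add: algebra_simps)
      finally show "0 \<le> k * \<Gamma> * (k - 2) - (k - \<Gamma>)" using k by simp
      have "\<Gamma> * (2 * k - 2) - 1 = 2 * (k * \<Gamma>) - 2 * \<Gamma> - 1" by (simp add: algebra_simps)
      then show "0 < \<Gamma> * (2 * k - 2) - 1" unfolding kG using k by simp
    qed (use pr in auto)
    ultimately have "W * (p\<^sup>2 * (1 - C)) < W * (C * (W\<^sup>2 - 2 * W * p - \<rho>\<^sup>2))" by linarith
    then show ?thesis using W0 by simp
  qed
  have A: "A = W * g * v - s * p" unfolding A_def hllc_A_def pr(6,7) by (simp add: v_def algebra_simps)
  have B: "B = W * g * u * v - p" unfolding B_def hllc_B_def pr(7) by (simp add: v_def u_def p_def)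
  have d: "(U$1 * v)\<^sup>2 = \<rho>\<^sup>2 * g * v\<^sup>2" unfolding pr(5) by (simp add: power_mult_distrib g_def)
  have "A\<^sup>2 - B\<^sup>2 = W\<^sup>2 * g * v\<^sup>2 * (g * (1 - u\<^sup>2)) - 2 * W * p * g * v * (s - u) - p\<^sup>2 * (1 - s\<^sup>2)"
    unfolding A B by (simp add: power2_eq_square algebra_simps)
  then have "A\<^sup>2 - B\<^sup>2 - (U$1 * v)\<^sup>2 = g * v\<^sup>2 * (W\<^sup>2 - 2 * W * p - \<rho>\<^sup>2) - p\<^sup>2 * (1 - s\<^sup>2)"
    unfolding d g v_def[symmetric] by (simp add: power2_eq_square algebra_simps)
  then have "C * (A\<^sup>2 - B\<^sup>2 - (U$1 * v)\<^sup>2)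
      = g * v\<^sup>2 * (C * (W\<^sup>2 - 2 * W * p - \<rho>\<^sup>2)) - p\<^sup>2 * (C * (1 - s\<^sup>2))"
    by (simp only:) (simp add: algebra_simps)
  moreover have "p\<^sup>2 * (C * (1 - s\<^sup>2)) \<le> p\<^sup>2 * (g * v\<^sup>2 * (1 - C))" 
    using s2' by (intro mult_left_mono) auto
  moreover have "g * v\<^sup>2 * (p\<^sup>2 * (1 - C)) < g * v\<^sup>2 * (C * (W\<^sup>2 - 2 * W * p - \<rho>\<^sup>2))"
    using key g0 v0 by (intro mult_strict_left_mono) auto
  ultimately have "C * (A\<^sup>2 - B\<^sup>2 - (U$1 * v)\<^sup>2) > 0" by (simp add: algebra_simps)
  then have "A\<^sup>2 - B\<^sup>2 - (U$1 * v)\<^sup>2 > 0" using C0 by (simp add: zero_less_mult_iff)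
  then show cone: "(hllc_B \<Gamma> s U)\<^sup>2 + (U$1 * (s - velocity \<Gamma> U))\<^sup>2 < (hllc_A s U)\<^sup>2"
    by (simp add: A_def B_def v_def u_def)
  then have "B\<^sup>2 < A\<^sup>2" unfolding A_def B_def by (smt (verit) zero_le_power2)
  then have BA: "\<bar>B\<bar> < \<bar>A\<bar>" by (simp add: abs_le_square_iff flip: not_le)
  \<comment> \<open>For the sign of \<open>A\<close>: since
    \<open>\<bar>u * B\<bar> < \<bar>A\<bar>\<close>, it is the sign of \<open>A - u * B\<close>,
    which simplifies to \<open>(W - p) * v\<close>.\<close>
  have "A - u * B = W * v * (g * (1 - u\<^sup>2)) - p * v"
    unfolding A B v_def by (simp add: power2_eq_square algebra_simps)
  then have "v * (A - u * B) = (W - p) * v\<^sup>2"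
    unfolding g by (simp only:) (simp add: power2_eq_square algebra_simps)
  then have pos: "v * (A - u * B) > 0" using W2 v0 pr(2) by simp
  have "\<bar>u * B\<bar> \<le> 1 * \<bar>B\<bar>" unfolding abs_mult using pr(3) by (intro mult_right_mono) auto
  with BA have "\<bar>u * B\<bar> < \<bar>A\<bar>" by simp
  with pos show "0 < (s - velocity \<Gamma> U) * hllc_A s U"
    unfolding u_def[symmetric] v_def[symmetric] A_def[symmetric] zero_less_mult_iff by linarith
qed

text \<open>\<open>t A\<^sub>s - B\<^sub>s\<close> contracts the stress-energy tensor with the normals of the lines of speed \<open>s\<close>
  and \<open>t\<close>, hence is symmetric in \<open>s\<close> and \<open>t\<close>.\<close>

lemma contraction_eq:
  assumes G: "1 < \<Gamma>" "\<Gamma> \<le> 2" and U: "U \<in> admissible \<Gamma>"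
  shows "t * hllc_A s U - hllc_B \<Gamma> s U
    = (U$3 + pressure \<Gamma> U) * (s - velocity \<Gamma> U) * (t - velocity \<Gamma> U) + pressure \<Gamma> U * (1 - s * t)"
proof -
  have "U$2 = (U$3 + pressure \<Gamma> U) * velocity \<Gamma> U"
    using admissible_primitives[OF G U] by (metis diff_add_cancel)
  then show ?thesis by (simp add: hllc_A_def hllc_B_def algebra_simps)
qed

text \<open>For \<open>t = s\<close> the right-hand side of \<open>contraction_eq\<close> is a
  nonnegative multiple of a square plus \<open>p * (1 - s\<^sup>2)\<close>.\<close>

lemma contraction_same_pos:
  assumes G: "1 < \<Gamma>" "\<Gamma> \<le> 2" and U: "U \<in> admissible \<Gamma>" and s: "\<bar>s\<bar> < 1"
  shows "0 < s * hllc_A s U - hllc_B \<Gamma> s U"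
proof -
  obtain \<rho> u p where pr: "\<rho> > 0" "p > 0" "\<bar>u\<bar> < 1" and U': "U = cons_state \<Gamma> (\<rho>, u, p)"
    using U by (auto simp: admissible_def prim_states_def)
  have p: "pressure \<Gamma> U = p" "velocity \<Gamma> U = u"
    unfolding U' pressure_def velocity_def prim_cons_state[OF G pr] by simp_all
  have "U$3 + p > 0" using cons_state_relations(2)[OF G(1) pr] by (simp add: U')
  then have "(U$3 + p) * (s - u)\<^sup>2 \<ge> 0" by simp
  moreover have "p * (1 - s\<^sup>2) > 0" using pr s by (simp add: abs_square_less_1)
  ultimately show ?thesis unfolding contraction_eq[OF G U] p by (simp add: power2_eq_square)
qed

text \<open>The speeds \<open>t\<close> and \<open>s\<close> lie on opposite sides of the sound
  cone. With \<open>v\<close> and \<open>w\<close> as below, the contraction equals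
  \<open>g * (p * w - (W - p) * v)\<close>. Multiplying the two supersonic conditions gives
  \<open>C * w \<le> v\<close>, so \<open>p < (W - p) * C\<close> suffices, and that is
  \<open>C < \<Gamma> - 1\<close>.\<close>

lemma contraction_opposite_neg:
  assumes G: "1 < \<Gamma>" "\<Gamma> \<le> 2" and U: "U \<in> admissible \<Gamma>" and s: "\<bar>s\<bar> < 1" and t: "\<bar>t\<bar> < 1"
    and c: "sound_speed \<Gamma> U * (1 - s * velocity \<Gamma> U) \<le> s - velocity \<Gamma> U"
      "sound_speed \<Gamma> U * (1 - t * velocity \<Gamma> U) \<le> velocity \<Gamma> U - t"
  shows "t * hllc_A s U - hllc_B \<Gamma> s U < 0" "s * hllc_A t U - hllc_B \<Gamma> t U < 0"
proof -
  obtain \<rho> W where *: "\<rho> > 0" "pressure \<Gamma> U > 0" "\<bar>velocity \<Gamma> U\<bar> < 1"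
    "W = \<rho> + \<Gamma> / (\<Gamma> - 1) * pressure \<Gamma> U"
    "U$3 = W * (lorentz (velocity \<Gamma> U))\<^sup>2 - pressure \<Gamma> U"
    "sound_speed \<Gamma> U \<ge> 0" "W * (sound_speed \<Gamma> U)\<^sup>2 = \<Gamma> * pressure \<Gamma> U"
    "(sound_speed \<Gamma> U)\<^sup>2 < \<Gamma> - 1"
    using admissible_primitives[OF G U] by metis
  define u where "u = velocity \<Gamma> U"
  define p where "p = pressure \<Gamma> U"
  define g where "g = (lorentz u)\<^sup>2"
  define C where "C = (sound_speed \<Gamma> U)\<^sup>2"
  define k where "k = \<Gamma> / (\<Gamma> - 1)"
  define v where "v = (s - u) * (u - t)"
  define w where "w = (1 - s * u) * (1 - t * u)"
  note pr = *[folded u_def p_def C_def, folded g_def k_def]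
  have k: "k \<ge> 2" using G by (simp add: k_def field_simps)
  have kp: "k * p \<ge> 2 * p" using k pr(2) by simp
  have Wp: "W > p" using pr(1,2,4) kp by linarith
  have su: "1 - s * u > 0" "1 - t * u > 0" using one_minus_mult_pos s t pr(3) by blast+
  have w: "w > 0" using su by (simp add: w_def)
  have g: "g * (1 - u\<^sup>2) = 1" using lorentz_sq pr(3) by (simp add: g_def)
  have g0: "g > 0" using lorentz_pos[OF pr(3)] by (simp add: g_def)
  have st: "1 - s * t = g * (w + v)"
  proof -
    have "w + v = (1 - s * t) * (1 - u\<^sup>2)"
      by (simp add: v_def w_def power2_eq_square algebra_simps)
    then have "g * (w + v) = (1 - s * t) * (g * (1 - u\<^sup>2))" by simp
    then show ?thesis by (simp add: g)
  qed
  have Cw: "C * w \<le> v"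
  proof -
    have "(sound_speed \<Gamma> U * (1 - s * u)) * (sound_speed \<Gamma> U * (1 - t * u)) \<le> v"
      unfolding v_def
    proof (rule mult_mono)
      show "0 \<le> s - u" using c(1) pr(6) su(1) unfolding u_def
        by (meson less_imp_le mult_nonneg_nonneg order_trans)
    qed (use c pr(6) su in \<open>auto simp: u_def\<close>)
    then show ?thesis by (simp add: C_def w_def power2_eq_square algebra_simps)
  qed
  have "p * C < p * (\<Gamma> - 1)" using pr(2,8) by simp
  then have "p < (W - p) * C" using pr(7) by (simp add: algebra_simps)
  then have "p * w < (W - p) * (C * w)" using w by (simp add: mult.assoc[symmetric])
  also have "\<dots> \<le> (W - p) * v" using Cw Wp by (intro mult_left_mono) auto
  finally have "g * (p * w) < g * ((W - p) * v)" using g0 by simp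
  then have neg: "(U$3 + p) * (s - u) * (t - u) + p * (1 - s * t) < 0"
    unfolding st pr(5) v_def by (simp add: algebra_simps)
  then show "t * hllc_A s U - hllc_B \<Gamma> s U < 0"
    unfolding contraction_eq[OF G U] by (simp add: u_def p_def)
  show "s * hllc_A t U - hllc_B \<Gamma> t U < 0"
    using neg unfolding contraction_eq[OF G U] by (simp add: u_def p_def algebra_simps)
qed

text \<open>Everything follows by clearing the positive denominators \<open>1 - c * u\<close> and
  \<open>1 + c * u\<close>; the bounds by the speed of light become
  \<open>(1 - c) * (1 + u) > 0\<close> and \<open>(1 - c) * (1 - u) > 0\<close>, with
  \<open>c < 1\<close> from \<open>\<Gamma> \<le> 2\<close>.\<close>

lemma supersonic_speeds:
  assumes G: "1 < \<Gamma>" "\<Gamma> \<le> 2" and U: "U \<in> admissible \<Gamma>"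
  shows "-1 < s_min \<Gamma> U" "s_max \<Gamma> U < 1"
    and "s \<ge> s_max \<Gamma> U \<Longrightarrow> sound_speed \<Gamma> U * (1 - s * velocity \<Gamma> U) \<le> s - velocity \<Gamma> U"
    and "s \<le> s_min \<Gamma> U \<Longrightarrow> sound_speed \<Gamma> U * (1 - s * velocity \<Gamma> U) \<le> velocity \<Gamma> U - s"
    and "s \<ge> s_max \<Gamma> U \<Longrightarrow> velocity \<Gamma> U < s"
    and "s \<le> s_min \<Gamma> U \<Longrightarrow> s < velocity \<Gamma> U"
proof -
  define u where "u = velocity \<Gamma> U"
  define c where "c = sound_speed \<Gamma> U"
  obtain W where *: "pressure \<Gamma> U > 0" "\<bar>velocity \<Gamma> U\<bar> < 1" "sound_speed \<Gamma> U \<ge> 0"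
    "W * (sound_speed \<Gamma> U)\<^sup>2 = \<Gamma> * pressure \<Gamma> U" "(sound_speed \<Gamma> U)\<^sup>2 < \<Gamma> - 1"
    using admissible_primitives[OF G U] by metis
  note u = *(2)[folded u_def] and c0 = *(3)[folded c_def] and c2 = *(5)[folded c_def]
  have c3: "c \<noteq> 0" using *(1,4) G by (auto simp: c_def)
  have c1: "c < 1" using c2 G power2_less_imp_less[of c 1] by simp
  have uc: "1 - c * u > 0" "1 - c * (- u) > 0" using one_minus_mult_pos[of c u] one_minus_mult_pos[of c "- u"] u c0 c1 by auto
  have f: "(1 - c) * (1 - u) > 0" "(1 - c) * (1 + u) > 0" using c1 u by auto
  show l: "-1 < s_min \<Gamma> U" using f uc
    unfolding s_min_def u_def[symmetric] c_def[symmetric] by (simp add: field_simps)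
  show r: "s_max \<Gamma> U < 1" using f uc
    unfolding s_max_def u_def[symmetric] c_def[symmetric] by (simp add: field_simps)
  have cpos: "c > 0" using c0 c3 by simp
  have R: "c * (1 - s * u) \<le> s - u" if "s \<ge> s_max \<Gamma> U" for s
    using that uc unfolding s_max_def u_def[symmetric] c_def[symmetric] by (simp add: field_simps)
  have L: "c * (1 - s * u) \<le> u - s" if "s \<le> s_min \<Gamma> U" for s
    using that uc unfolding s_min_def u_def[symmetric] c_def[symmetric] by (simp add: field_simps)
  have "u < s_max \<Gamma> U" "s_min \<Gamma> U < u"
  proof -
    have "c * u\<^sup>2 < c * 1" using cpos u by (intro mult_strict_left_mono) (auto simp: abs_square_less_1)
    then show "u < s_max \<Gamma> U" "s_min \<Gamma> U < u"
      using uc unfolding s_max_def s_min_def u_def[symmetric] c_def[symmetric]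
      by (simp_all add: field_simps power2_eq_square)
  qed
  then show "s \<ge> s_max \<Gamma> U \<Longrightarrow> velocity \<Gamma> U < s" "s \<le> s_min \<Gamma> U \<Longrightarrow> s < velocity \<Gamma> U"
    by (auto simp: u_def)
  show "sound_speed \<Gamma> U * (1 - s * velocity \<Gamma> U) \<le> s - velocity \<Gamma> U" if "s \<ge> s_max \<Gamma> U"
    using R[OF that] by (simp add: u_def c_def)
  show "sound_speed \<Gamma> U * (1 - s * velocity \<Gamma> U) \<le> velocity \<Gamma> U - s" if "s \<le> s_min \<Gamma> U"
    using L[OF that] by (simp add: u_def c_def)
qed

section \<open>The contact speed\<close>

text \<open>This is the cofactor left after dividing the quadratic in \<open>y\<close> by
  \<open>y - r\<close>. It is affine in \<open>y\<close>, and the signs of the quadratic at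
  \<open>-1\<close> and \<open>1\<close> make it negative at both ends.\<close>

lemma quadratic_slope_neg:
  fixes a b c r y :: real
  assumes "c + b * r + a * r\<^sup>2 = 0" "c - b + a > 0" "c + b + a < 0" "\<bar>r\<bar> < 1" "\<bar>y\<bar> \<le> 1"
  shows "b + a * (y + r) < 0"
proof -
  have "(1 - r) * (b + a * (1 + r)) = c + b + a"
    using assms(1) by (simp add: power2_eq_square algebra_simps)
  then have 1: "b + a * (1 + r) < 0" using assms(3,4) by (smt (verit) mult_nonneg_nonneg)
  have "(1 + r) * (b + a * (r - 1)) = - (c - b + a)"
    using assms(1) by (simp add: power2_eq_square algebra_simps)
  then have 2: "b + a * (r - 1) < 0" using assms(2,4) by (smt (verit) mult_nonneg_nonneg)
  have "\<bar>a * y\<bar> \<le> \<bar>a\<bar> * 1" unfolding abs_mult using assms(5) by (intro mult_left_mono) auto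
  with 1 2 show ?thesis by (simp add: algebra_simps)
qed

text \<open>The intermediate value theorem supplies a root \<open>z\<close> inside; the formula is
  then shown to return \<open>z\<close>.\<close>

lemma quadratic_inner_root:
  fixes a b c :: real
  assumes "c - b + a > 0" "c + b + a < 0"
  defines "r \<equiv> (if a = 0 then - c / b else (- b - sqrt (b\<^sup>2 - 4 * c * a)) / (2 * a))"
  shows "\<bar>r\<bar> < 1" "c + b * r + a * r\<^sup>2 = 0"
proof -
  define q where "q = (\<lambda>x. c + b * x + a * x\<^sup>2)"
  have "continuous_on {-1..1} q" unfolding q_def by (intro continuous_intros)
  moreover have "q 1 \<le> 0" "0 \<le> q (-1)" using assms by (simp_all add: q_def)
  ultimately obtain z where z: "-1 \<le> z" "z \<le> 1" "q z = 0"
    using IVT2'[of q 1 0 "-1"] by auto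
  moreover have "z \<noteq> 1" "z \<noteq> -1" using z(3) assms by (auto simp: q_def)
  ultimately have z1: "\<bar>z\<bar> < 1" by simp
  have root: "c + b * z + a * z\<^sup>2 = 0" using z(3) by (simp add: q_def)
  have neg: "b + a * (z + z) < 0"
    using quadratic_slope_neg[OF root assms(1,2) z1, of z] z1 by linarith
  have "r = z"
  proof (cases "a = 0")
    case True
    with root neg show ?thesis by (simp add: r_def field_simps)
  next
    case False
    have "c = - b * z - a * z\<^sup>2" using root by simp
    \<comment> \<open>The discriminant is the squared derivative at \<open>z\<close>. That
      derivative is negative, so the minus sign before the square root selects
      \<open>z\<close>.\<close>
    then have "b\<^sup>2 - 4 * c * a = (b + a * (z + z))\<^sup>2"
      by (simp only:) (simp add: power2_eq_square algebra_simps)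
    then have "sqrt (b\<^sup>2 - 4 * c * a) = - (b + a * (z + z))" using neg by simp
    with False show ?thesis by (simp add: r_def field_simps)
  qed
  with z1 root show "\<bar>r\<bar> < 1" "c + b * r + a * r\<^sup>2 = 0" by simp_all
qed

text \<open>The cross-multiplied difference of the two pressure formulas; in this form the signs at
  \<open>-1\<close>, \<open>1\<close> and the outer speeds can be read off term by term.\<close>

lemma hllc_quadratic:
  "hllc_C0 \<Gamma> sm sp Um Up + hllc_C1 \<Gamma> sm sp Um Up * x + hllc_C2 sm sp Um Up * x\<^sup>2
    = (x * hllc_A sm Um - hllc_B \<Gamma> sm Um) * (1 - sp * x)
      - (x * hllc_A sp Up - hllc_B \<Gamma> sp Up) * (1 - sm * x)"
  by (simp add: hllc_C0_def hllc_C1_def hllc_C2_def power2_eq_square algebra_simps)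

section \<open>The intermediate states\<close>

text \<open>Reduces to \<open>admissible_star\<close>: \<open>m = (E + p) * u\<close> turns
  \<open>E * (s - u) - p * u\<close> into \<open>A\<close>. The hypothesis \<open>side\<close> puts
  \<open>x\<close> and the fluid velocity on the same side of \<open>s\<close>.\<close>

lemma star_state_admissible:
  assumes G: "1 < \<Gamma>" "\<Gamma> \<le> 2" and U: "U \<in> admissible \<Gamma>" and s: "\<bar>s\<bar> < 1" "\<bar>x\<bar> < 1"
    and c: "sound_speed \<Gamma> U * (1 - s * velocity \<Gamma> U) \<le> \<bar>s - velocity \<Gamma> U\<bar>"
    and side: "(s - x) * (s - velocity \<Gamma> U) > 0"
    and P: "P = (x * hllc_A s U - hllc_B \<Gamma> s U) / (1 - s * x)"
  shows "star_state \<Gamma> s x P U \<in> admissible \<Gamma>"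
proof -
  note cone = outer_wave_cone[OF G U s(1) c]
  have E: "U$1 > 0" "U$2 = (U$3 + pressure \<Gamma> U) * velocity \<Gamma> U"
    using admissible_primitives[OF G U] lorentz_pos by (metis mult_pos_pos, metis diff_add_cancel)
  have "U$3 * (s - velocity \<Gamma> U) + P * x - pressure \<Gamma> U * velocity \<Gamma> U = hllc_A s U + P * x"
    unfolding hllc_A_def E(2) by (simp add: algebra_simps)
  moreover have "U$2 * (s - velocity \<Gamma> U) + P - pressure \<Gamma> U = hllc_B \<Gamma> s U + P"
    by (simp add: hllc_B_def)
  ultimately have eq: "star_state \<Gamma> s x P U = vector [U$1 * (s - velocity \<Gamma> U) / (s - x),
      (hllc_B \<Gamma> s U + P) / (s - x), (hllc_A s U + P * x) / (s - x)]"
    by (simp only: star_state_def Let_def)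
  have "(s - x) * hllc_A s U > 0" "(s - x) * (U$1 * (s - velocity \<Gamma> U)) > 0"
    using cone(2) side E(1) by (auto simp: zero_less_mult_iff mult_less_0_iff)
  then show ?thesis unfolding eq using admissible_star[OF G(1) s cone(1)] P by simp
qed

theorem theorem2p2:
  fixes \<Gamma> sm sp :: real and Um Up :: "real ^ 3"
  assumes "1 < \<Gamma>" and "\<Gamma> \<le> 2"
    and "Um \<in> admissible \<Gamma>" and "Up \<in> admissible \<Gamma>"
    and "sm = min (s_min \<Gamma> Um) (s_min \<Gamma> Up)"
    and "sp = max (s_max \<Gamma> Um) (s_max \<Gamma> Up)"
  shows "hllc_minus \<Gamma> sm sp Um Up \<in> admissible \<Gamma> \<and> hllc_plus \<Gamma> sm sp Um Up \<in> admissible \<Gamma>"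
proof -
  note G = assms(1,2) and Um = assms(3) and Up = assms(4)
  note wm = supersonic_speeds[OF G Um] and wp = supersonic_speeds[OF G Up]
  have le: "sm \<le> s_min \<Gamma> Um" "sm \<le> s_min \<Gamma> Up" "s_max \<Gamma> Um \<le> sp" "s_max \<Gamma> Up \<le> sp"
    using assms(5,6) by auto
  have bnd: "-1 < sm" "sp < 1" using assms(5,6) wm(1,2) wp(1,2) by auto
  have um: "sm < velocity \<Gamma> Um" "velocity \<Gamma> Um < sp" using wm(5,6) le bnd by auto
  have up: "sm < velocity \<Gamma> Up" "velocity \<Gamma> Up < sp" using wp(5,6) le bnd by auto
  have s: "\<bar>sm\<bar> < 1" "\<bar>sp\<bar> < 1" using um bnd by auto
  \<comment> \<open>The minimum and maximum make both outer speeds supersonic for both states; the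
    pairing with the opposite state is what separates the contact speed from the outer
    speeds.\<close>
  note cm = wm(3)[OF le(3)] wm(4)[OF le(1)] and cp = wp(3)[OF le(4)] wp(4)[OF le(2)]
  have cm': "sound_speed \<Gamma> Um * (1 - sm * velocity \<Gamma> Um) \<le> \<bar>sm - velocity \<Gamma> Um\<bar>"
    and cp': "sound_speed \<Gamma> Up * (1 - sp * velocity \<Gamma> Up) \<le> \<bar>sp - velocity \<Gamma> Up\<bar>"
    using cm(2) cp(1) by linarith+
  define Am where "Am = hllc_A sm Um"
  define Bm where "Bm = hllc_B \<Gamma> sm Um"
  define Ap where "Ap = hllc_A sp Up"
  define Bp where "Bp = hllc_B \<Gamma> sp Up"
  note conem = outer_wave_cone[OF G Um s(1) cm', folded Am_def Bm_def]
  note conep = outer_wave_cone[OF G Up s(2) cp', folded Ap_def Bp_def]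
  have "Bm\<^sup>2 < Am\<^sup>2" "Bp\<^sup>2 < Ap\<^sup>2" using conem(1) conep(1) by (smt (verit) zero_le_power2)+
  then have "\<bar>Bm\<bar> < \<bar>Am\<bar>" "\<bar>Bp\<bar> < \<bar>Ap\<bar>" by (simp_all add: abs_le_square_iff flip: not_le)
  moreover have "Am < 0" "Ap > 0" using conem(2) conep(2) um up by (auto simp: zero_less_mult_iff)
  ultimately have AB: "\<bar>Bm\<bar> < - Am" "\<bar>Bp\<bar> < Ap" by simp_all
  define C0 where "C0 = hllc_C0 \<Gamma> sm sp Um Up"
  define C1 where "C1 = hllc_C1 \<Gamma> sm sp Um Up"
  define C2 where "C2 = hllc_C2 sm sp Um Up"
  define x where "x = contact_speed \<Gamma> sm sp Um Up"
  note q = hllc_quadratic[of \<Gamma> sm sp Um Up, folded C0_def C1_def C2_def Am_def Bm_def Ap_def Bp_def]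
  have q1: "C0 - C1 + C2 > 0"
  proof -
    have "C0 - C1 + C2 = (- Am - Bm) * (1 + sp) + (Ap + Bp) * (1 + sm)"
      using q[of "-1"] by (simp add: algebra_simps)
    then show ?thesis using AB s by (simp add: add_pos_pos)
  qed
  have q2: "C0 + C1 + C2 < 0"
  proof -
    have "C0 + C1 + C2 = - ((- Am + Bm) * (1 - sp) + (Ap - Bp) * (1 - sm))"
      using q[of 1] by (simp add: algebra_simps)
    moreover have "- Am + Bm > 0" "Ap - Bp > 0" "1 - sp > 0" "1 - sm > 0" using AB s by linarith+
    then have "(- Am + Bm) * (1 - sp) + (Ap - Bp) * (1 - sm) > 0"
      by (meson add_pos_pos mult_pos_pos)
    ultimately show ?thesis by simp
  qed
  have x: "x = (if C2 = 0 then - C0 / C1 else (- C1 - sqrt (C1\<^sup>2 - 4 * C0 * C2)) / (2 * C2))"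
    by (simp add: x_def contact_speed_def Let_def C0_def C1_def C2_def)
  have x1: "\<bar>x\<bar> < 1" and root: "C0 + C1 * x + C2 * x\<^sup>2 = 0"
    using quadratic_inner_root[OF q1 q2] unfolding x by simp_all
  have diff: "C0 + C1 * y + C2 * y\<^sup>2 = (y - x) * (C1 + C2 * (y + x))" for y
    using root by (simp add: power2_eq_square algebra_simps)
  have neg: "C1 + C2 * (y + x) < 0" if "\<bar>y\<bar> < 1" for y
    using quadratic_slope_neg[OF root q1 q2 x1] that by simp
  have ss: "1 - sm * sp > 0" "1 - sp * sp > 0" "1 - sm * sm > 0"
    using one_minus_mult_pos s by auto
  \<comment> \<open>The quadratic is negative at \<open>sp\<close>: the left state contributes an
    opposite contraction, the right state a diagonal one. A negative cofactor then forces
    \<open>sp - x > 0\<close>. The argument at \<open>sm\<close> is the mirror image.\<close>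
  have "x < sp"
  proof -
    have "(sp * Am - Bm) * (1 - sp * sp) < 0"
      using contraction_opposite_neg(2)[OF G Um s(2,1) cm] ss
      by (simp add: Am_def Bm_def mult_neg_pos)
    moreover have "(sp * Ap - Bp) * (1 - sm * sp) > 0"
      using contraction_same_pos[OF G Up s(2)] ss by (simp add: Ap_def Bp_def)
    ultimately have "(sp - x) * (C1 + C2 * (sp + x)) < 0" using q[of sp] diff[of sp] by linarith
    then show ?thesis using neg[OF s(2)] by (auto simp: mult_less_0_iff)
  qed
  moreover have "sm < x"
  proof -
    have "(sm * Ap - Bp) * (1 - sm * sm) < 0"
      using contraction_opposite_neg(1)[OF G Up s(2,1) cp] ss
      by (simp add: Ap_def Bp_def mult_neg_pos)
    moreover have "(sm * Am - Bm) * (1 - sp * sm) > 0"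
      using contraction_same_pos[OF G Um s(1)] ss by (simp add: Am_def Bm_def mult.commute)
    ultimately have "(sm - x) * (C1 + C2 * (sm + x)) > 0" using q[of sm] diff[of sm] by linarith
    then show ?thesis using neg[OF s(1)] by (auto simp: zero_less_mult_iff)
  qed
  ultimately have side: "(sm - x) * (sm - velocity \<Gamma> Um) > 0" "(sp - x) * (sp - velocity \<Gamma> Up) > 0"
    using um up by (simp_all add: mult_neg_neg)
  define P where "P = star_pressure \<Gamma> sm sp Um Up"
  have P: "P = (x * hllc_A sm Um - hllc_B \<Gamma> sm Um) / (1 - sm * x)"
    by (simp add: P_def star_pressure_def Let_def x_def)
  have "1 - sm * x > 0" "1 - sp * x > 0" using one_minus_mult_pos s x1 by auto
  then have P': "P = (x * hllc_A sp Up - hllc_B \<Gamma> sp Up) / (1 - sp * x)"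
    using star_pressure_sides root unfolding P C0_def C1_def C2_def by force
  show ?thesis
    unfolding hllc_minus_def hllc_plus_def x_def[symmetric] P_def[symmetric]
    using star_state_admissible[OF G Um s(1) x1 cm' side(1) P]
      star_state_admissible[OF G Up s(2) x1 cp' side(2) P'] ..
qed

end
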